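(* Let $n\ge 1$ and let $\mathbf{t}=(t_1,\dots,t_m)$ be a strictly increasing sequence of elements of $[n]$ (so $t_m\le n$). Then $\mathrm{Split}(\mathrm{IPC}_n(\mathbf{t}))=\mathrm{IPF}^*_{n,\mathbf{t}}$ and $\mathrm{Join}(\mathrm{IPF}^*_{n,\mathbf{t}})=\mathrm{IPC}_n(\mathbf{t})$.
   Context: $[n]=\{1,\dots,n\}$. Let $\mathbf{u}=(u_1,\dots,u_{n-m})$ be the elements of $[n]\setminus\{t_1,\dots,t_m\}$ in increasing order; $\mathrm{IPC}_n(\mathbf{t})$ is the set of weakly increasing $(c_1,\dots,c_{n-m})\in[n]^{n-m}$ with $c_i\le u_i$ for all $i$. An increasing parking function (IPF) of length $\ell\ge0$ is a weakly increasing sequence $(a_1,\dots,a_\ell)$ of positive integers with $a_j\le j$ for all $j$ (the empty sequence included). $\mathrm{IPF}^*$ is the set of finite lists of IPFs (of arbitrary lengths), regarded as infinite lists padded by empty IPFs. $\mathrm{IPF}^*_{n,\mathbf{t}}$ is the set of $(\mathbf{a}^{(1)},\dots,\mathbf{a}^{(m+1)})\in\mathrm{IPF}^*$ such that, with $L_i=|\mathbf{a}^{(1)}|+\dots+|\mathbf{a}^{(i)}|$, we have $L_i\ge t_i-i$ for all $i\in[m]$ and $L_{m+1}=n-m$. For a list $\mathbf{a}$ and integer $x$, $\mathbf{a}\oplus x$ ($\mathbf{a}\ominus x$) adds (subtracts) $x$ to each entry, and $\bullet$ is concatenation. $\mathrm{Join}(\mathbf{a}^{(1)},\dots,\mathbf{a}^{(r)})=\mathbf{b}^{(1)}\bullet\cdots\bullet\mathbf{b}^{(r)}$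 where $\mathbf{b}^{(i)}=\mathbf{a}^{(i)}\oplus(L_{i-1}+i-1)$, $L_0=0$. $\mathrm{Split}$ of a weakly increasing sequence $\mathbf{p}$ of positive integers: $\mathrm{Split}(())=()$; otherwise, with $\mathbf{a}$ the longest prefix of $\mathbf{p}$ that is an IPF and $\mathbf{p}=\mathbf{a}\bullet\mathbf{q}$, $\mathrm{Split}(\mathbf{p})=(\mathbf{a})$ if $\mathbf{q}$ is empty and otherwise $\mathbf{a}$ followed by the entries of $\mathrm{Split}(\mathbf{q}\ominus(|\mathbf{a}|+1))$. *)

theory Defs
  imports Main
begin

definition IPF :: "nat list \<Rightarrow> bool" where
  "IPF a \<longleftrightarrow> sorted a \<and> (\<forall>j\<in>{1..length a}. 1 \<le> a ! (j - 1) \<and> a ! (j - 1) \<le> j)"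

definition add_all :: "nat list \<Rightarrow> nat \<Rightarrow> nat list"  (infixl \<open>\<oplus>\<close> 65) where
  "a \<oplus> x = map (\<lambda>y. y + x) a"

definition sub_all :: "nat list \<Rightarrow> nat \<Rightarrow> nat list"  (infixl \<open>\<ominus>\<close> 65) where
  "a \<ominus> x = map (\<lambda>y. y - x) a"

definition IPC :: "nat \<Rightarrow> nat list \<Rightarrow> nat list set" where
  "IPC n t = (let u = sorted_list_of_set ({1..n} - set t) in
     {c. length c = n - length t \<and> set c \<subseteq> {1..n} \<and> sorted c \<and>
         (\<forall>i < n - length t. c ! i \<le> u ! i)})"

text \<open>\<open>L as i\<close> is the total length of the first \<open>i\<close> entries of \<open>as\<close>.\<close>

definition L :: "nat list list \<Rightarrow> nat \<Rightarrow> nat" where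
  "L as i = sum_list (map length (take i as))"

text \<open>
  A finite list of IPFs stands for the infinite list obtained by padding with empty IPFs.
  We work with the finite lists; equality in \<open>IPF_star\<close> is equality after applying \<open>pad\<close>.
\<close>

definition pad :: "nat list list \<Rightarrow> (nat \<Rightarrow> nat list)" where
  "pad as = (\<lambda>i. if i < length as then as ! i else [])"

definition IPF_star :: "nat list list set" where
  "IPF_star = {as. \<forall>a\<in>set as. IPF a}"

text \<open>
  The condition \<open>L\<^sub>i \<ge> t\<^sub>i - i\<close> is written additively to avoid truncated subtraction.
  In \<open>n - length t\<close> there is no truncation for strictly increasing \<open>t\<close> with entries in \<open>{1..n}\<close>.
\<close>

definition IPF_star_nt :: "nat \<Rightarrow> nat list \<Rightarrow> nat list list set" where
  "IPF_star_nt n t = {as \<in> IPF_star. length as = length t + 1 \<and>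
     (\<forall>i\<in>{1..length t}. L as i + i \<ge> t ! (i - 1)) \<and>
     L as (length t + 1) = n - length t}"

text \<open>With 0-based indexing, entry \<open>i\<close> (the \<open>(i+1)\<close>-st one) is shifted by \<open>L\<^sub>i + i\<close>.\<close>

definition Join :: "nat list list \<Rightarrow> nat list" where
  "Join as = concat (map (\<lambda>i. (as ! i) \<oplus> (L as i + i)) [0..<length as])"

definition longest_IPF_prefix :: "nat list \<Rightarrow> nat list" where
  "longest_IPF_prefix p = take (GREATEST k. k \<le> length p \<and> IPF (take k p)) p"

text \<open>
  \<open>Split\<close> is meaningful only on weakly increasing lists of positive integers; elsewhere it
  returns the dummy value \<open>[]\<close>. On this domain the first entry of the nonempty remainder
  \<open>q\<close> exceeds \<open>length a + 1\<close>, so the subtraction never truncates and the recursion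
  stays within the domain.
\<close>

function Split :: "nat list \<Rightarrow> nat list list" where
  "Split p =
     (if p = [] \<or> \<not> (sorted p \<and> (\<forall>x\<in>set p. 1 \<le> x)) then []
      else let a = longest_IPF_prefix p; q = drop (length a) p in
        if q = [] then [a] else a # Split (q \<ominus> (length a + 1)))"
  by pat_completeness auto

lemma sum_list_sub_all_less:
  "q \<noteq> [] \<Longrightarrow> \<forall>x\<in>set q. 1 \<le> x \<Longrightarrow> sum_list (q \<ominus> Suc d) < sum_list q"
proof (induction q)
  case (Cons x q)
  have "sum_list (q \<ominus> Suc d) \<le> sum_list q"
    unfolding sub_all_def using sum_list_mono[of q "\<lambda>y. y - Suc d" "\<lambda>y. y"] by simp
  moreover have "x - Suc d < x" using Cons.prems by auto
  ultimately show ?case by (simp add: sub_all_def)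
qed simp

termination Split
proof (relation "measure sum_list")
  fix p a q :: "nat list"
  assume "\<not> (p = [] \<or> \<not> (sorted p \<and> (\<forall>x\<in>set p. 1 \<le> x)))"
    and q: "q = drop (length a) p" "q \<noteq> []"
  then have "\<forall>x\<in>set q. 1 \<le> x" by (auto dest: in_set_dropD)
  then have "sum_list (q \<ominus> Suc (length a)) < sum_list q"
    by (rule sum_list_sub_all_less[OF q(2)])
  also have "\<dots> \<le> sum_list p"
    using sum_list_append[of "take (length a) p" "drop (length a) p"] q(1) by simp
  finally show "(q \<ominus> (length a + 1), p) \<in> measure sum_list" by simp
qed simp

declare Split.simps [simp del]

text \<open>\<open>Join\<close> does not depend on the finite list chosen to represent a padded list.\<close>

lemma Join_append_replicate_Nil: "Join (as @ replicate k []) = Join as"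
proof -
  have "Join (as @ replicate k []) =
      concat (map (\<lambda>i. (as @ replicate k []) ! i \<oplus> (L (as @ replicate k []) i + i)) [0..<length as])
    @ concat (map (\<lambda>i. (as @ replicate k []) ! i \<oplus> (L (as @ replicate k []) i + i))
        [length as..<length as + k])"
    by (simp only: Join_def length_append length_replicate upt_add_eq_append[OF le0]
        map_append concat_append)
  moreover have "concat (map (\<lambda>i. (as @ replicate k []) ! i \<oplus> (L (as @ replicate k []) i + i))
        [length as..<length as + k]) = []"
    by (auto simp: add_all_def nth_append)
  moreover have "map (\<lambda>i. (as @ replicate k []) ! i \<oplus> (L (as @ replicate k []) i + i)) [0..<length as]
      = map (\<lambda>i. as ! i \<oplus> (L as i + i)) [0..<length as]"
    by (auto simp: nth_append L_def)
  ultimately show ?thesis by (simp add: Join_def)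
qed

lemma Join_cong_pad:
  assumes "pad as = pad bs"
  shows "Join as = Join bs"
proof -
  have *: "Join xs = Join ys" if eq: "pad xs = pad ys" and le: "length xs \<le> length ys" for xs ys
  proof -
    have ys: "ys = xs @ replicate (length ys - length xs) []"
    proof (rule nth_equalityI)
      fix i assume "i < length ys"
      then show "ys ! i = (xs @ replicate (length ys - length xs) []) ! i"
        using fun_cong[OF eq, of i] le by (auto simp: pad_def nth_append split: if_splits)
    qed (use le in simp)
    show ?thesis by (subst ys) (rule Join_append_replicate_Nil[symmetric])
  qed
  show ?thesis
    using *[OF assms] *[OF assms[symmetric]] linear[of "length as" "length bs"] by auto
qed

end

theory Submission
  imports Defs
begin

text \<open>
  Up to padding, \<open>Join\<close> and \<open>Split\<close> are mutually inverse, so everything reduces to comparing the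
  two side conditions. Counting the elements of \<open>{1..n} - set t\<close> below \<open>x\<close> turns
  \<open>c\<^sub>j \<le> u\<^sub>j\<close> into \<open>c\<^sub>j \<le> j + #{k. t\<^sub>k < c\<^sub>j}\<close>. An entry \<open>c\<^sub>j\<close> lying in the \<open>i\<close>-th block of \<open>Join\<close>
  satisfies \<open>L\<^sub>i\<^sub>-\<^sub>1 + i \<le> c\<^sub>j \<le> j + i - 1\<close>, with equality on the left at the start of the block, so the
  condition says that \<open>t\<^sub>i\<^sub>-\<^sub>1 < c\<^sub>j\<close> at the start of each nonempty block.
\<close>

section \<open>Strictly increasing lists\<close>

text \<open>In a strictly increasing list the elements below \<open>x\<close> occupy an initial
  segment, so their number tells which indices belong to it.\<close>

lemma nth_less_iff_less_card:
  fixes u :: "'a::linorder list"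
  assumes "sorted_wrt (<) u" "j < length u"
  shows "u ! j < x \<longleftrightarrow> j < card {y \<in> set u. y < x}"
proof
  assume less: "u ! j < x"
  have "set (take (Suc j) u) \<subseteq> {y \<in> set u. y < x}"
  proof
    fix y assume "y \<in> set (take (Suc j) u)"
    then obtain i where i: "i < Suc j" "y = u ! i" "i < length u"
      by (auto simp: in_set_conv_nth)
    then have "y \<le> u ! j"
      using sorted_wrt_nth_less[OF assms(1), of i j] assms(2) by (cases "i = j") auto
    then show "y \<in> {y \<in> set u. y < x}" using i less by auto
  qed
  then have "card (set (take (Suc j) u)) \<le> card {y \<in> set u. y < x}"
    by (intro card_mono) auto
  moreover have "distinct (take (Suc j) u)"
    using assms(1) by (simp add: strict_sorted_iff)
  ultimately show "j < card {y \<in> set u. y < x}"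
    using assms(2) by (simp add: distinct_card)
next
  assume less: "j < card {y \<in> set u. y < x}"
  show "u ! j < x"
  proof (rule ccontr)
    assume not_less: "\<not> u ! j < x"
    have "{y \<in> set u. y < x} \<subseteq> set (take j u)"
    proof
      fix y assume y: "y \<in> {y \<in> set u. y < x}"
      then obtain i where i: "y = u ! i" "i < length u" by (auto simp: in_set_conv_nth)
      have "i < j"
      proof (rule ccontr)
        assume "\<not> i < j"
        then have "u ! j \<le> u ! i"
          using sorted_wrt_nth_less[OF assms(1), of j i] i by (cases "i = j") auto
        then show False using y i not_less by auto
      qed
      then show "y \<in> set (take j u)" using i by (auto simp: in_set_conv_nth)
    qed
    then have "card {y \<in> set u. y < x} \<le> card (set (take j u))"
      by (intro card_mono) auto
    also have "\<dots> \<le> j" using card_length[of "take j u"] by simp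
    finally show False using less by simp
  qed
qed

text \<open>Consecutive entries differ by at least 1. This carries an upper bound on a later entry
  back to an earlier one.\<close>

lemma strict_sorted_nth_gap:
  fixes t :: "nat list"
  assumes "sorted_wrt (<) t" "k \<le> i" "i < length t"
  shows "t ! k + (i - k) \<le> t ! i"
  using assms(2,3)
proof (induction i rule: dec_induct)
  case (step i)
  then show ?case using sorted_wrt_nth_less[OF assms(1), of i "Suc i"] by simp
qed simp

text \<open>The \<open>x - 1\<close> positive integers below \<open>x\<close> split into those in
  \<open>T\<close> and those in the complement list; entry \<open>j\<close> of that list is below
  \<open>x\<close> iff the second kind number more than \<open>j\<close>.\<close>

lemma le_nth_complement_iff:
  assumes "T \<subseteq> {1..n}" "x \<in> {1..n}" "j < n - card T"
  shows "x \<le> sorted_list_of_set ({1..n} - T) ! j \<longleftrightarrow> x \<le> j + 1 + card {y \<in> T. y < x}"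
proof -
  let ?u = "sorted_list_of_set ({1..n} - T)"
  have fin: "finite T" using assms(1) by (rule finite_subset) simp
  have len: "length ?u = n - card T"
    using assms(1) fin by (simp add: card_Diff_subset)
  have "{1..<x} = {y \<in> {1..n} - T. y < x} \<union> {y \<in> T. y < x}"
    using assms(1,2) by auto
  moreover have "card ({y \<in> {1..n} - T. y < x} \<union> {y \<in> T. y < x})
      = card {y \<in> {1..n} - T. y < x} + card {y \<in> T. y < x}"
    using fin by (intro card_Un_disjoint) auto
  ultimately have "x - 1 = card {y \<in> {1..n} - T. y < x} + card {y \<in> T. y < x}"
    by (metis card_atLeastLessThan)
  moreover have "?u ! j < x \<longleftrightarrow> j < card {y \<in> {1..n} - T. y < x}"
    using nth_less_iff_less_card[of ?u j x] assms(3) len by simp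
  ultimately show ?thesis using assms(2) by auto
qed

text \<open>Eliminates the complement list: from here on only counts of entries of \<open>t\<close>
  matter.\<close>

lemma IPC_iff:
  assumes "sorted_wrt (<) t" "set t \<subseteq> {1..n}"
  shows "c \<in> IPC n t \<longleftrightarrow> length c = n - length t \<and> set c \<subseteq> {1..n} \<and> sorted c \<and>
    (\<forall>j < length c. c ! j \<le> j + 1 + card {y \<in> set t. y < c ! j})"
proof -
  have "card (set t) = length t"
    using assms(1) by (simp add: distinct_card strict_sorted_iff)
  then have "c ! j \<le> sorted_list_of_set ({1..n} - set t) ! j
      \<longleftrightarrow> c ! j \<le> j + 1 + card {y \<in> set t. y < c ! j}"
    if "length c = n - length t" "set c \<subseteq> {1..n}" "j < length c" for j
    using le_nth_complement_iff[OF assms(2) subsetD[OF that(2) nth_mem[OF that(3)]]] that(1,3)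
    by simp
  then show ?thesis unfolding IPC_def Let_def by auto
qed

section \<open>Blocks of a join\<close>

lemma IPF_iff: "IPF a \<longleftrightarrow> sorted a \<and> (\<forall>j < length a. 1 \<le> a ! j \<and> a ! j \<le> j + 1)"
proof -
  have "(\<forall>j\<in>{1..length a}. P (j - 1) j) \<longleftrightarrow> (\<forall>j < length a. P j (j + 1))" for P
    by (metis Suc_eq_plus1 Suc_leI Suc_pred' add_diff_cancel_right' atLeastAtMost_iff
        le_add2 less_Suc_eq_le less_eq_Suc_le zero_less_Suc One_nat_def)
  from this[of "\<lambda>i j. 1 \<le> a ! i \<and> a ! i \<le> j"] show ?thesis
    unfolding IPF_def by simp
qed

lemma IPF_Nil [simp]: "IPF []"
  by (simp add: IPF_def)

lemma IPF_entries:
  assumes "IPF a" "x \<in> set a"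
  shows "1 \<le> x" "x \<le> length a"
proof -
  obtain j where "j < length a" "x = a ! j" using assms(2) by (auto simp: in_set_conv_nth)
  then show "1 \<le> x" "x \<le> length a" using assms(1) by (fastforce simp: IPF_iff)+
qed

lemma L_0 [simp]: "L as 0 = 0"
  by (simp add: L_def)

lemma L_Cons_Suc [simp]: "L (a # as) (Suc i) = length a + L as i"
  by (simp add: L_def)

lemma L_Suc: "i < length as \<Longrightarrow> L as (Suc i) = L as i + length (as ! i)"
  by (simp add: L_def take_Suc_conv_app_nth)

lemma L_mono: "i \<le> j \<Longrightarrow> L as i \<le> L as j"
  using sum_list_append[of "map length (take i as)" "map length (take (j - i) (drop i as))"]
  by (metis L_def le_add_diff_inverse map_append le_add1 take_add)

lemma Join_Nil [simp]: "Join [] = []"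
  by (simp add: Join_def)

text \<open>Prepending a block raises every later shift by its length plus one index step. This form
  mirrors the recursion of \<open>Split\<close> and drives the inductions below.\<close>

lemma Join_Cons: "Join (a # as) = a @ (Join as \<oplus> (length a + 1))"
proof -
  have "map (\<lambda>i. (a # as) ! i \<oplus> (L (a # as) i + i)) [0..<length (a # as)]
    = (a \<oplus> 0) # map (\<lambda>i. as ! i \<oplus> (length a + L as i + Suc i)) [0..<length as]"
    unfolding length_Cons upt_rec[of 0 "Suc _"]
    by (simp add: map_Suc_upt[symmetric] del: upt_Suc)
  then show ?thesis
    by (simp add: Join_def add_all_def map_concat o_def ac_simps)
qed

lemma length_Join: "length (Join as) = L as (length as)"
  by (induction as) (auto simp: Join_Cons add_all_def)

lemma Join_nth:
  assumes "i < length as" "k < length (as ! i)"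
  shows "L as i + k < length (Join as)"
    and "Join as ! (L as i + k) = as ! i ! k + L as i + i"
proof -
  have "L as i + k < length (Join as) \<and> Join as ! (L as i + k) = as ! i ! k + L as i + i"
    using assms
  proof (induction as arbitrary: i)
    case (Cons a as)
    then show ?case
      by (cases i) (auto simp: Join_Cons add_all_def nth_append)
  qed simp
  then show "L as i + k < length (Join as)"
    and "Join as ! (L as i + k) = as ! i ! k + L as i + i" by auto
qed

lemma Join_index:
  assumes "j < length (Join as)"
  obtains i k where "i < length as" "k < length (as ! i)" "j = L as i + k"
proof -
  have "\<exists>i k. i < length as \<and> k < length (as ! i) \<and> j = L as i + k"
    using assms
  proof (induction as arbitrary: j)
    case (Cons a as)
    show ?case
    proof (cases "j < length a")
      case True
      then show ?thesis by (intro exI[of _ 0] exI[of _ j]) simp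
    next
      case False
      then have "j - length a < length (Join as)"
        using Cons.prems by (simp add: Join_Cons add_all_def)
      from Cons.IH[OF this] obtain i k
        where "i < length as" "k < length (as ! i)" "j - length a = L as i + k" by blast
      then show ?thesis using False by (intro exI[of _ "Suc i"] exI[of _ k]) simp
    qed
  qed simp
  then show ?thesis using that by blast
qed

lemma Join_pos: "as \<in> IPF_star \<Longrightarrow> \<forall>x\<in>set (Join as). 1 \<le> x"
  by (induction as) (auto simp: IPF_star_def Join_Cons add_all_def dest: IPF_entries)

lemma sorted_add_all: "sorted p \<Longrightarrow> sorted (p \<oplus> x)"
  by (simp add: add_all_def sorted_map sorted_wrt_iff_nth_less)

text \<open>Across the seam, entries of the first block are at most its length, while the shift puts
  all later ones above that.\<close>

lemma sorted_Join: "as \<in> IPF_star \<Longrightarrow> sorted (Join as)"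
proof (induction as)
  case (Cons a as)
  then have "IPF a" "as \<in> IPF_star" by (auto simp: IPF_star_def)
  with Cons.IH show ?case
    by (auto simp: Join_Cons sorted_append sorted_add_all IPF_def)
      (auto simp: add_all_def dest!: IPF_entries(2)[OF \<open>IPF a\<close>])
qed simp

section \<open>Splitting and joining are inverse\<close>

lemma longest_IPF_prefix_eqI:
  assumes "k \<le> length p" "IPF (take k p)"
    and "\<And>l. \<lbrakk>l \<le> length p; IPF (take l p)\<rbrakk> \<Longrightarrow> l \<le> k"
  shows "longest_IPF_prefix p = take k p"
proof -
  have "(GREATEST l. l \<le> length p \<and> IPF (take l p)) = k"
    using assms by (intro Greatest_equality) auto
  then show ?thesis by (simp add: longest_IPF_prefix_def)
qed

text \<open>By the strict gap in the last claim, subtracting \<open>length a + 1\<close> does not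
  truncate and leaves positive entries, so \<open>Split\<close> recurses within its domain.\<close>

lemma longest_IPF_prefix_props:
  assumes p: "sorted p" "\<forall>x\<in>set p. 1 \<le> x"
  defines "a \<equiv> longest_IPF_prefix p"
  shows "IPF a" "p = a @ drop (length a) p"
    and "\<forall>x\<in>set (drop (length a) p). length a + 1 < x"
proof -
  let ?P = "\<lambda>k. k \<le> length p \<and> IPF (take k p)"
  define k where "k = (GREATEST k. ?P k)"
  have k: "?P k" unfolding k_def by (rule GreatestI_nat[of ?P 0 "length p"]) auto
  have max: "l \<le> k" if "?P l" for l
    unfolding k_def using that by (intro Greatest_le_nat[of ?P l "length p"]) auto
  have a: "a = take k p" and len: "length a = k"
    using k by (auto simp: a_def k_def longest_IPF_prefix_def)
  show "IPF a" "p = a @ drop (length a) p" using k by (simp_all add: a len)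
  show "\<forall>x\<in>set (drop (length a) p). length a + 1 < x"
  proof
    fix x assume "x \<in> set (drop (length a) p)"
    then obtain i where "i < length (drop k p)" "x = drop k p ! i"
      by (auto simp only: len in_set_conv_nth)
    then have i: "k + i < length p" "x = p ! (k + i)" by simp_all
    have "\<not> IPF (take (Suc k) p)" using max[of "Suc k"] i by auto
    \<comment> \<open>Sortedness and positivity are inherited from \<open>p\<close>, and the earlier
      bounds from the maximal prefix, so only the upper bound at index \<open>k\<close> can
      fail.\<close>
    then have "\<not> p ! k \<le> k + 1"
      using k i p by (auto simp: IPF_iff sorted_wrt_take less_Suc_eq)
    moreover have "p ! k \<le> x" using i p(1) by (auto intro: sorted_nth_mono)
    ultimately show "length a + 1 < x" using len by simp
  qed
qed

text \<open>After the shift the first entry of \<open>q\<close>, if any, is at least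
  \<open>length a + 2\<close>, too large for index \<open>length a\<close>, so no longer prefix is
  an IPF.\<close>

lemma longest_IPF_prefix_append:
  assumes "IPF a" "\<forall>x\<in>set q. 1 \<le> x"
  shows "longest_IPF_prefix (a @ (q \<oplus> (length a + 1))) = a"
proof -
  let ?p = "a @ (q \<oplus> (length a + 1))"
  have "longest_IPF_prefix ?p = take (length a) ?p"
  proof (rule longest_IPF_prefix_eqI)
    fix l assume l: "l \<le> length ?p" "IPF (take l ?p)"
    show "l \<le> length a"
    proof (rule ccontr)
      assume *: "\<not> l \<le> length a"
      then have "take l ?p ! length a \<le> length a + 1"
        using l unfolding IPF_iff by auto
      moreover have "q \<noteq> []" using * l by (auto simp: add_all_def)
      then have "take l ?p ! length a = q ! 0 + (length a + 1)" "1 \<le> q ! 0"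
        using * assms(2) by (auto simp: add_all_def nth_append)
      ultimately show False by simp
    qed
  qed (use assms in auto)
  then show ?thesis by simp
qed

lemma Split_Nil [simp]: "Split [] = []"
  by (simp add: Split.simps)

lemma add_all_sub_all: "\<forall>x\<in>set q. d \<le> x \<Longrightarrow> (q \<ominus> d) \<oplus> d = q"
  by (auto simp: add_all_def sub_all_def intro: map_idI)

lemma sub_all_add_all: "(q \<oplus> d) \<ominus> d = q"
  by (simp add: add_all_def sub_all_def o_def)

text \<open>Nonemptiness of the last block is what later bounds the number of blocks.\<close>

lemma Split_props:
  assumes "sorted p" "\<forall>x\<in>set p. 1 \<le> x"
  shows "Split p \<in> IPF_star" "Join (Split p) = p" "p \<noteq> [] \<Longrightarrow> Split p \<noteq> [] \<and> last (Split p) \<noteq> []"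
proof -
  have "Split p \<in> IPF_star \<and> Join (Split p) = p \<and>
      (p \<noteq> [] \<longrightarrow> Split p \<noteq> [] \<and> last (Split p) \<noteq> [])"
    using assms
  proof (induction p rule: Split.induct)
    case (1 p)
    define a where "a = longest_IPF_prefix p"
    define q where "q = drop (length a) p"
    note props = longest_IPF_prefix_props[OF "1.prems", folded a_def, folded q_def]
    show ?case
    proof (cases "p = [] \<or> q = []")
      case True
      then have "Split p = (if p = [] then [] else [a])"
        using "1.prems" by (auto simp: Split.simps[of p] Let_def a_def q_def)
      then show ?thesis using True props by (auto simp: IPF_star_def Join_Cons add_all_def)
    next
      case False
      let ?q = "q \<ominus> (length a + 1)"
      have split: "Split p = a # Split ?q"
        using False "1.prems" by (simp add: Split.simps[of p] Let_def a_def q_def)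
      have "sorted q" using "1.prems" by (simp add: q_def sorted_wrt_drop)
      then have "sorted ?q"
        by (auto simp: sub_all_def sorted_wrt_iff_nth_less intro!: diff_le_mono)
      moreover have "\<forall>x\<in>set ?q. 1 \<le> x"
        using props(3) by (auto simp: sub_all_def)
      ultimately have "Split ?q \<in> IPF_star \<and> Join (Split ?q) = ?q \<and>
          (?q \<noteq> [] \<longrightarrow> Split ?q \<noteq> [] \<and> last (Split ?q) \<noteq> [])"
        using "1.IH"[OF _ a_def q_def] False "1.prems" by simp
      moreover have "?q \<noteq> []" using False by (simp add: sub_all_def)
      moreover have "a @ (?q \<oplus> (length a + 1)) = p"
        using props(2,3) add_all_sub_all[of q "length a + 1"] by force
      ultimately show ?thesis
        using props(1) unfolding split by (auto simp: IPF_star_def Join_Cons)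
    qed
  qed
  then show "Split p \<in> IPF_star" "Join (Split p) = p"
    "p \<noteq> [] \<Longrightarrow> Split p \<noteq> [] \<and> last (Split p) \<noteq> []" by auto
qed

lemma pad_Nil: "pad [] = (\<lambda>_. [])"
  by (simp add: pad_def)

lemma pad_Cons: "pad (a # as) = case_nat a (pad as)"
  by (auto simp: pad_def fun_eq_iff split: nat.split)

lemma pad_append_replicate_Nil: "pad (as @ replicate k []) = pad as"
  by (auto simp: pad_def fun_eq_iff nth_append)

text \<open>Padding is essential because \<open>Split\<close> drops trailing empty blocks; empty
  blocks before a nonempty one are recovered as empty longest prefixes.\<close>

lemma pad_Split_Join: "as \<in> IPF_star \<Longrightarrow> pad (Split (Join as)) = pad as"
proof (induction as)
  case Nil
  show ?case by simp
next
  case (Cons a as)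
  then have a: "IPF a" and as: "as \<in> IPF_star" by (auto simp: IPF_star_def)
  let ?p = "Join (a # as)"
  have prefix: "longest_IPF_prefix ?p = a"
    using longest_IPF_prefix_append[OF a Join_pos[OF as]] by (simp add: Join_Cons)
  have dom: "sorted ?p \<and> (\<forall>x\<in>set ?p. 1 \<le> x)"
    using sorted_Join[OF Cons.prems] Join_pos[OF Cons.prems] by simp
  have drop: "drop (length a) ?p = Join as \<oplus> (length a + 1)"
    by (simp add: Join_Cons)
  show ?case
  proof (cases "Join as = []")
    case True
    then have "pad as = pad []" using Cons.IH[OF as] by simp
    \<comment> \<open>Here \<open>?p\<close> is just \<open>a\<close>; if \<open>a\<close> is empty
      too, \<open>Split\<close> returns no block rather than one empty block.\<close>
    moreover have "Split ?p = (if a = [] then [] else [a])"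
      using True dom prefix by (auto simp: Split.simps[of a] Join_Cons add_all_def)
    ultimately show ?thesis
      by (auto simp: pad_Cons pad_Nil fun_eq_iff split: nat.split)
  next
    case False
    then have "Split ?p = a # Split (Join as)"
      using dom prefix drop
      by (auto simp: Split.simps[of ?p] Let_def sub_all_add_all) (auto simp: Join_Cons add_all_def)
    then show ?thesis by (simp add: pad_Cons Cons.IH[OF as])
  qed
qed

section \<open>Comparing the side conditions\<close>

text \<open>With 0-based indices, entry \<open>j\<close> in block \<open>i\<close> is at most
  \<open>j + 1 + i\<close> and, for \<open>i > 0\<close>, exceeds \<open>t ! (i - 1)\<close>, so at
  least \<open>i\<close> entries of \<open>t\<close> lie below it.\<close>

lemma Join_in_IPC:
  assumes t: "sorted_wrt (<) t" "set t \<subseteq> {1..n}" and as: "as \<in> IPF_star_nt n t"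
  shows "Join as \<in> IPC n t"
proof -
  have star: "as \<in> IPF_star" and len: "length as = length t + 1"
    and tL: "\<And>i. i \<in> {1..length t} \<Longrightarrow> t ! (i - 1) \<le> L as i + i"
    and Ln: "L as (length t + 1) = n - length t"
    using as by (auto simp: IPF_star_nt_def)
  have len_Join: "length (Join as) = n - length t" using length_Join[of as] len Ln by simp
  have bounds: "Join as ! j \<le> n \<and> Join as ! j \<le> j + 1 + card {y \<in> set t. y < Join as ! j}"
    if j: "j < length (Join as)" for j
  proof -
    obtain i k where ik: "i < length as" "k < length (as ! i)" "j = L as i + k"
      using Join_index[OF j] .
    have val: "Join as ! j = as ! i ! k + L as i + i" using Join_nth(2)[OF ik(1,2)] ik(3) by simp
    have "IPF (as ! i)" using star ik(1) by (auto simp: IPF_star_def)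
    then have x: "1 \<le> as ! i ! k" "as ! i ! k \<le> k + 1" using ik(2) by (auto simp: IPF_iff)
    have "i \<le> card {y \<in> set t. y < Join as ! j}"
    proof (cases i)
      case (Suc i')
      then have "t ! i' < Join as ! j" using tL[of i] ik(1) len val x(1) by auto
      then show ?thesis using nth_less_iff_less_card[OF t(1), of i'] Suc ik(1) len by simp
    qed simp
    \<comment> \<open>Both bounds start from \<open>j + 1 + i\<close>: the one by \<open>n\<close>
      uses \<open>j < n - length t\<close> and \<open>i \<le> length t\<close>, the other the
      count.\<close>
    then show ?thesis using val x ik len j len_Join by auto
  qed
  then have "set (Join as) \<subseteq> {1..n}" using Join_pos[OF star] by (auto simp: in_set_conv_nth)
  then show ?thesis
    using bounds len_Join sorted_Join[OF star] by (simp add: IPC_iff[OF t])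
qed

text \<open>If \<open>L as k + k < t ! (k - 1)\<close>, the first entry after the first
  \<open>k\<close> blocks violates the bound in \<open>IPC_iff\<close>.\<close>

lemma IPF_star_ntI:
  assumes t: "sorted_wrt (<) t" "set t \<subseteq> {1..n}"
    and star: "as \<in> IPF_star" and len: "length as = length t + 1" and Join: "Join as \<in> IPC n t"
  shows "as \<in> IPF_star_nt n t"
proof -
  have len_Join: "length (Join as) = n - length t"
    and le: "\<And>j. j < length (Join as) \<Longrightarrow>
      Join as ! j \<le> j + 1 + card {y \<in> set t. y < Join as ! j}"
    using Join by (auto simp: IPC_iff[OF t])
  have "t ! (k - 1) \<le> L as k + k" if k: "k \<in> {1..length t}" for k
  proof (rule ccontr)
    assume contra: "\<not> t ! (k - 1) \<le> L as k + k"
    \<comment> \<open>The later entries of \<open>t\<close> must fit between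
      \<open>t ! (k - 1)\<close> and \<open>n\<close>, which leaves
      \<open>L as k < n - length t\<close>: some entry does follow the first \<open>k\<close>
      blocks.\<close>
    have "t ! (k - 1) + (length t - 1 - (k - 1)) \<le> t ! (length t - 1)"
      using k by (intro strict_sorted_nth_gap[OF t(1)]) auto
    moreover have "t ! (length t - 1) \<le> n" using t(2) k nth_mem[of "length t - 1" t] by fastforce
    ultimately have j: "L as k < length (Join as)" using contra k len_Join by auto
    obtain i l where il: "i < length as" "l < length (as ! i)" "L as k = L as i + l"
      using Join_index[OF j] .
    \<comment> \<open>Position \<open>L as k\<close> is the start of a nonempty block
      \<open>i\<close> beyond the first \<open>k\<close>; any blocks skipped are empty, hence
      \<open>l = 0\<close>.\<close>
    have "k \<le> i"
    proof (rule ccontr)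
      assume "\<not> k \<le> i"
      then have "L as (Suc i) \<le> L as k" by (intro L_mono) simp
      then show False using L_Suc[OF il(1)] il by simp
    qed
    with L_mono[OF this, of as] il(3) have l: "l = 0" "L as i = L as k" by auto
    have "IPF (as ! i)" using star il(1) by (auto simp: IPF_star_def)
    then have "as ! i ! 0 = 1" using il(2) l by (auto simp: IPF_iff intro!: le_antisym)
    then have val: "Join as ! L as k = L as k + i + 1"
      using Join_nth(2)[OF il(1,2)] l by simp
    then have "i \<le> card {y \<in> set t. y < Join as ! L as k}" using le[OF j] by simp
    then have "t ! (i - 1) < L as k + i + 1"
      using nth_less_iff_less_card[OF t(1), of "i - 1" "Join as ! L as k"] val k \<open>k \<le> i\<close> il(1) len
      by auto
    \<comment> \<open>Going back from \<open>t ! (i - 1) \<le> L as k + i\<close> to index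
      \<open>k - 1\<close> loses at least \<open>i - k\<close>, giving
      \<open>t ! (k - 1) \<le> L as k + k\<close>.\<close>
    moreover have "t ! (k - 1) + (i - 1 - (k - 1)) \<le> t ! (i - 1)"
      using k \<open>k \<le> i\<close> il(1) len by (intro strict_sorted_nth_gap[OF t(1)]) auto
    ultimately show False using contra k \<open>k \<le> i\<close> by auto
  qed
  then show ?thesis
    using star len len_Join length_Join[of as] by (simp add: IPF_star_nt_def)
qed

text \<open>The last block, at index \<open>i\<close>, is nonempty and starts with an entry at least
  \<open>L (Split c) i + i + 1\<close>; the bound in \<open>IPC_iff\<close> there forces
  \<open>i \<le> length t\<close>.\<close>

lemma length_Split_le:
  assumes t: "sorted_wrt (<) t" "set t \<subseteq> {1..n}" and c: "c \<in> IPC n t"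
  shows "length (Split c) \<le> length t + 1"
proof (cases "c = []")
  case True
  then show ?thesis by simp
next
  case False
  have dom: "sorted c" "\<forall>x\<in>set c. 1 \<le> x" using c by (auto simp: IPC_iff[OF t])
  note split = Split_props[OF dom]
  define i where "i = length (Split c) - 1"
  have i: "i < length (Split c)" "0 < length (Split c ! i)"
    using split(3)[OF False] by (auto simp: i_def last_conv_nth)
  then have "1 \<le> Split c ! i ! 0"
    using split(1) by (auto simp: IPF_star_def IPF_iff)
  then have "L (Split c) i + i + 1 \<le> c ! L (Split c) i"
    using Join_nth(2)[OF i] split(2) by simp
  also have "\<dots> \<le> L (Split c) i + 1 + card {y \<in> set t. y < c ! L (Split c) i}"
    using c Join_nth(1)[OF i] split(2) by (auto simp: IPC_iff[OF t])
  also have "card {y \<in> set t. y < c ! L (Split c) i} \<le> length t"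
    by (rule order_trans[OF card_mono card_length]) auto
  finally show ?thesis by (simp add: i_def)
qed

text \<open>\<open>Split\<close> may return fewer than \<open>length t + 1\<close> blocks; appending
  empty ones changes neither \<open>pad\<close> nor \<open>Join\<close>.\<close>

lemma obtain_IPF_star_nt:
  assumes t: "sorted_wrt (<) t" "set t \<subseteq> {1..n}" and c: "c \<in> IPC n t"
  obtains as where "as \<in> IPF_star_nt n t" "pad as = pad (Split c)" "Join as = c"
proof
  let ?as = "Split c @ replicate (length t + 1 - length (Split c)) []"
  have dom: "sorted c" "\<forall>x\<in>set c. 1 \<le> x" using c by (auto simp: IPC_iff[OF t])
  note split = Split_props[OF dom]
  show "pad ?as = pad (Split c)" by (rule pad_append_replicate_Nil)
  show Join: "Join ?as = c" using split(2) by (simp only: Join_append_replicate_Nil)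
  show "?as \<in> IPF_star_nt n t"
  proof (rule IPF_star_ntI[OF t])
    show "?as \<in> IPF_star" using split(1) by (auto simp: IPF_star_def)
    show "length ?as = length t + 1" using length_Split_le[OF t c] by simp
    show "Join ?as \<in> IPC n t" using c Join by simp
  qed
qed

theorem theorem4p4:
  fixes n :: nat and t :: "nat list"
  assumes "n \<ge> 1"
    and "sorted_wrt (<) t"
    and "set t \<subseteq> {1..n}"
  shows "pad ` (Split ` IPC n t) = pad ` IPF_star_nt n t \<and>
         Join ` IPF_star_nt n t = IPC n t"
proof -
  note t = assms(2,3)
  have Join: "Join as \<in> IPC n t" if "as \<in> IPF_star_nt n t" for as
    using Join_in_IPC[OF t that] .
  have "pad as \<in> pad ` (Split ` IPC n t)" if "as \<in> IPF_star_nt n t" for as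
  proof -
    have "pad as = pad (Split (Join as))"
      using that by (intro pad_Split_Join[symmetric]) (simp add: IPF_star_nt_def)
    then show ?thesis using Join[OF that] by blast
  qed
  moreover have "pad (Split c) \<in> pad ` IPF_star_nt n t \<and> c \<in> Join ` IPF_star_nt n t"
    if "c \<in> IPC n t" for c
    using obtain_IPF_star_nt[OF t that] by (metis imageI)
  ultimately show ?thesis using Join by auto
qed

end
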